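(* Let $N \geq 1$ be an integer and let $\mathcal{M} \subseteq M_{2^N}(\mathbb{C})$ be a set of matrices. Then $$\mathcal{M}\mathrm{SU}(2^N) := \{A \in \mathrm{SU}(2^N) : AB = BA \ \text{for all } B \in \mathcal{M}\}$$ is a compact Lie subgroup of $\mathrm{SU}(2^N)$, i.e. a subgroup that is an embedded compact submanifold of $\mathrm{SU}(2^N)$.
   Context: $M_{2^N}(\mathbb{C})$ is the set of $2^N\times 2^N$ complex matrices; $\mathrm{SU}(2^N)$ is the Lie group of unitary $2^N\times 2^N$ matrices of determinant one. *)

theory Defs
  imports "HOL-Analysis.Analysis" "HOL-Algebra.Group"
begin

section \<open>Smooth maps and submanifolds in Euclidean spaces\<close>

text \<open>
  For open \<open>S\<close> in a finite-dimensional space, \<open>Ck_on k f S\<close> says that \<open>f\<close> is of class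
  \<open>C\<^sup>k\<close> on \<open>S\<close>: all directional derivatives of order up to \<open>k\<close> exist as
  derivatives of Frechet differentiable maps and are continuous.
\<close>

primrec Ck_on ::
    "nat \<Rightarrow> ('a::real_normed_vector \<Rightarrow> 'b::real_normed_vector) \<Rightarrow> 'a set \<Rightarrow> bool" where
  "Ck_on 0 f S \<longleftrightarrow> continuous_on S f"
| "Ck_on (Suc k) f S \<longleftrightarrow>
     (\<forall>x\<in>S. f differentiable (at x)) \<and>
     (\<forall>v. Ck_on k (\<lambda>x. frechet_derivative f (at x) v) S)"

text \<open>Smoothness on an arbitrary subset of a Euclidean space: local extendability to a
  \<open>C\<^sup>\<infinity>\<close> map on an open neighbourhood.\<close>

definition smooth_map ::
    "'a::euclidean_space set \<Rightarrow> ('a \<Rightarrow> 'b::euclidean_space) \<Rightarrow> bool" where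
  "smooth_map A f \<longleftrightarrow>
     (\<forall>x\<in>A. \<exists>W g. open W \<and> x \<in> W \<and> (\<forall>k. Ck_on k g W) \<and> (\<forall>y\<in>W \<inter> A. g y = f y))"

text \<open>
  A chart of \<open>X\<close> with domain \<open>U\<close>, for the smooth structure inherited from the
  ambient Euclidean space: a diffeomorphism from a relatively open \<open>U \<subseteq> X\<close> onto an open
  subset of the model space \<open>L\<close>. A \<open>k\<close>-dimensional linear subspace \<open>L\<close> of the
  ambient space plays the role of \<open>\<real>\<^sup>k\<close>; this is no restriction, as
  \<open>k\<close> never exceeds the dimension of the ambient space.
\<close>

definition smooth_chart ::
    "'a::euclidean_space set \<Rightarrow> 'a set \<Rightarrow> 'a set \<Rightarrow> ('a \<Rightarrow> 'a) \<Rightarrow> bool" where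
  "smooth_chart X L U \<phi> \<longleftrightarrow>
     subspace L \<and> openin (top_of_set X) U \<and> openin (top_of_set L) (\<phi> ` U) \<and>
     inj_on \<phi> U \<and> smooth_map U \<phi> \<and> smooth_map (\<phi> ` U) (inv_into U \<phi>)"

definition smooth_manifold :: "nat \<Rightarrow> 'a::euclidean_space set \<Rightarrow> bool" where
  "smooth_manifold k X \<longleftrightarrow> (\<forall>p\<in>X. \<exists>L U \<phi>. p \<in> U \<and> dim L = k \<and> smooth_chart X L U \<phi>)"

text \<open>
  \<open>Z\<close> is an embedded (regular) submanifold of the manifold \<open>X\<close>: around each of its
  points there is a slice chart of \<open>X\<close>, i.e. one in which \<open>Z\<close> becomes an open piece
  of a \<open>d\<close>-dimensional coordinate subspace. The slice is taken through the origin of the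
  model space, which can always be achieved by a translation.
\<close>

definition embedded_submanifold :: "'a::euclidean_space set \<Rightarrow> 'a set \<Rightarrow> bool" where
  "embedded_submanifold X Z \<longleftrightarrow> Z \<subseteq> X \<and>
     (\<exists>k d. smooth_manifold k X \<and>
        (\<forall>p\<in>Z. \<exists>L L' U \<phi>. p \<in> U \<and> dim L = k \<and> smooth_chart X L U \<phi> \<and>
            subspace L' \<and> L' \<subseteq> L \<and> dim L' = d \<and> \<phi> ` (U \<inter> Z) = \<phi> ` U \<inter> L'))"

definition compact_Lie_subgroup :: "'a::euclidean_space monoid \<Rightarrow> 'a set \<Rightarrow> bool" where
  "compact_Lie_subgroup G H \<longleftrightarrow>
     subgroup H G \<and> compact H \<and> embedded_submanifold (carrier G) H"


section \<open>The special unitary group and commutants\<close>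

definition adjoint_matrix :: "complex^'n^'n \<Rightarrow> complex^'n^'n" where
  "adjoint_matrix A = (\<chi> i j. cnj (A $ j $ i))"

definition unitary_matrix :: "complex^'n^'n \<Rightarrow> bool" where
  "unitary_matrix A \<longleftrightarrow> adjoint_matrix A ** A = mat 1 \<and> A ** adjoint_matrix A = mat 1"

definition SU_group :: "(complex^'n^'n) monoid" where
  "SU_group = \<lparr>carrier = {A. unitary_matrix A \<and> det A = 1}, mult = (**), one = mat 1\<rparr>"

definition commutant_SU :: "(complex^'n^'n) set \<Rightarrow> (complex^'n^'n) set" where
  "commutant_SU M = {A \<in> carrier SU_group. \<forall>B\<in>M. A ** B = B ** A}"

lemma adjoint_matrix_mult: "adjoint_matrix (A ** B) = adjoint_matrix B ** adjoint_matrix A"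
  by (simp add: adjoint_matrix_def matrix_matrix_mult_def vec_eq_iff mult.commute)

lemma adjoint_matrix_adjoint [simp]: "adjoint_matrix (adjoint_matrix A) = A"
  by (simp add: adjoint_matrix_def vec_eq_iff)

lemma adjoint_matrix_one [simp]: "adjoint_matrix (mat 1) = mat 1"
  by (simp add: adjoint_matrix_def mat_def vec_eq_iff)

lemma unitary_matrix_mult:
  assumes "unitary_matrix A" "unitary_matrix B"
  shows "unitary_matrix (A ** B)"
  using assms unfolding unitary_matrix_def adjoint_matrix_mult
  by (metis matrix_mul_assoc matrix_mul_rid)

lemma unitary_matrix_one: "unitary_matrix (mat 1)"
  by (simp add: unitary_matrix_def)

lemma group_SU_group: "group SU_group"
proof (rule groupI)
  fix A :: "complex^'n^'n"
  assume A: "A \<in> carrier SU_group"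
  then have u: "unitary_matrix (adjoint_matrix A)"
    by (simp add: SU_group_def unitary_matrix_def)
  have "det (adjoint_matrix A) * det A = det (adjoint_matrix A ** A)"
    by (simp add: det_mul)
  with A have "det (adjoint_matrix A) = 1"
    by (simp add: SU_group_def unitary_matrix_def)
  with u have "adjoint_matrix A \<in> carrier SU_group"
    by (simp add: SU_group_def)
  moreover have "adjoint_matrix A ** A = mat 1"
    using A by (simp add: SU_group_def unitary_matrix_def)
  ultimately show "\<exists>B\<in>carrier SU_group. B \<otimes>\<^bsub>SU_group\<^esub> A = \<one>\<^bsub>SU_group\<^esub>"
    by (auto simp: SU_group_def)
qed (auto simp: SU_group_def unitary_matrix_mult det_mul matrix_mul_assoc unitary_matrix_one)

end

theory Submission
  imports Defs
begin

text \<open>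
  Near the identity, \<open>SU(n)\<close> is cut out linearly by the polynomial coordinate map
  \<open>F(A) = (A - A\<^sup>*)/2 + (A\<^sup>*A - 1)/2 + \<i> (Im (det A) - Im (tr A))/n\<close>: its derivative at \<open>1\<close> is
  injective, and \<open>F(A)\<close> is skew-Hermitian and traceless iff \<open>A\<close> is unitary with real determinant.
  Moreover, for unitary \<open>A\<close> near \<open>1\<close>, \<open>F(A)\<close> commutes with a matrix \<open>B\<close> iff \<open>A\<close> does, so the
  commutant becomes a linear subspace of the Lie algebra. The smooth inverse function theorem turns
  \<open>F\<close> into a slice chart at \<open>1\<close>, and left translation by \<open>p\<close> moves it to any \<open>p\<close> in the commutant.
\<close>

section \<open>Calculus of smooth maps\<close>

lemma Ck_on_cong:
  assumes "open S" "Ck_on k f S" "\<And>x. x \<in> S \<Longrightarrow> f x = g x"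
  shows "Ck_on k g S"
  using assms(2,3)
proof (induction k arbitrary: f g)
  case 0
  then show ?case by (simp cong: continuous_on_cong)
next
  case (Suc k)
  have eq: "frechet_derivative f (at x) = frechet_derivative g (at x)" "g differentiable (at x)"
    if "x \<in> S" for x
  proof -
    have d: "f differentiable (at x)" using Suc.prems that by simp
    show "frechet_derivative f (at x) = frechet_derivative g (at x)"
      by (rule frechet_derivative_transform_within_open[OF d \<open>open S\<close> that Suc.prems(2)])
    show "g differentiable (at x)"
      using d has_derivative_transform_within_open[of f _ x UNIV S g, OF _ \<open>open S\<close> that Suc.prems(2)]
      unfolding differentiable_def by blast
  qed
  have "Ck_on k (\<lambda>x. frechet_derivative g (at x) v) S" for v
    by (rule Suc.IH[of "\<lambda>x. frechet_derivative f (at x) v"]) (use Suc.prems eq in auto)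
  then show ?case using eq by simp
qed

text \<open>Uniqueness of the derivative lets any explicit formula \<open>f'\<close> stand in for
  \<open>frechet_derivative\<close>. The closure lemmas below feed their differentiation rules
  through this.\<close>

lemma Ck_on_SucI:
  assumes "open S" "\<And>x. x \<in> S \<Longrightarrow> (f has_derivative f' x) (at x)"
    and "\<And>v. Ck_on k (\<lambda>x. f' x v) S"
  shows "Ck_on (Suc k) f S"
proof -
  have "f differentiable (at x)" and eq: "f' x = frechet_derivative f (at x)" if "x \<in> S" for x
    using assms(2)[OF that] frechet_derivative_at by (auto simp: differentiable_def)
  moreover have "Ck_on k (\<lambda>x. frechet_derivative f (at x) v) S" for v
    by (rule Ck_on_cong[OF assms(1) assms(3)]) (simp add: eq)
  ultimately show ?thesis by simp
qed

lemma Ck_on_Suc_derivative: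
  assumes "Ck_on (Suc k) f S" "x \<in> S"
  shows "(f has_derivative frechet_derivative f (at x)) (at x)"
  using assms by (simp flip: frechet_derivative_works)

lemma Ck_on_Suc_imp: "Ck_on (Suc k) f S \<Longrightarrow> Ck_on k f S"
proof (induction k arbitrary: f)
  case 0
  then show ?case
    by (auto intro!: continuous_at_imp_continuous_on differentiable_imp_continuous_within)
next
  case (Suc k)
  show ?case unfolding Ck_on.simps(2)[of k]
    using Suc.IH Suc.prems Ck_on.simps(2)[of "Suc k"] by blast
qed

lemma Ck_on_continuous: "Ck_on k f S \<Longrightarrow> continuous_on S f"
  by (induction k) (auto dest: Ck_on_Suc_imp simp del: Ck_on.simps(2))

lemma Ck_on_subset: "Ck_on k f S \<Longrightarrow> T \<subseteq> S \<Longrightarrow> Ck_on k f T"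
  by (induction k arbitrary: f) (auto intro: continuous_on_subset)

lemma Ck_on_const: "Ck_on k (\<lambda>x. c) S"
  by (induction k arbitrary: c) auto

lemma Ck_on_linear:
  assumes "bounded_linear f"
  shows "Ck_on k f S"
proof (cases k)
  case 0
  then show ?thesis using assms by (simp add: linear_continuous_on)
next
  case (Suc m)
  \<comment> \<open>\<open>Ck_on_SucI\<close> asks for an open set while \<open>S\<close> is
    arbitrary, so the claim is shown on the whole space, where the derivative is the constant
    \<open>f\<close>, and then restricted.\<close>
  have "Ck_on k f UNIV" unfolding Suc
    by (rule Ck_on_SucI[where f' = "\<lambda>_. f"])
      (auto simp: Ck_on_const assms bounded_linear_imp_has_derivative)
  then show ?thesis by (rule Ck_on_subset) simp
qed

section \<open>Closure of C^k maps under sums, products and composition\<close>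

lemma Ck_on_add:
  assumes "open S" "Ck_on k f S" "Ck_on k g S"
  shows "Ck_on k (\<lambda>x. f x + g x) S"
  using assms(2,3)
proof (induction k arbitrary: f g)
  case 0
  then show ?case by (simp add: continuous_on_add)
next
  case (Suc k)
  show ?case
  proof (rule Ck_on_SucI[OF assms(1)])
    show "((\<lambda>x. f x + g x) has_derivative
        (\<lambda>h. frechet_derivative f (at x) h + frechet_derivative g (at x) h)) (at x)" if "x \<in> S" for x
      by (rule has_derivative_add[OF Ck_on_Suc_derivative[OF Suc.prems(1) that]
            Ck_on_Suc_derivative[OF Suc.prems(2) that]])
    show "Ck_on k (\<lambda>x. frechet_derivative f (at x) v + frechet_derivative g (at x) v) S" for v
      by (rule Suc.IH) (use Suc.prems in simp_all)
  qed
qed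

lemma Ck_on_sum:
  assumes "open S" "\<And>i. i \<in> I \<Longrightarrow> Ck_on k (f i) S"
  shows "Ck_on k (\<lambda>x. \<Sum>i\<in>I. f i x) S"
  using assms(2)
  by (induction I rule: infinite_finite_induct) (auto simp: Ck_on_const Ck_on_add[OF assms(1)])

text \<open>By the product rule each directional derivative is a sum of two products of C^k maps, so
  the induction hypothesis applies to both summands once the undifferentiated factor is lowered from
  order \<open>Suc k\<close> to \<open>k\<close>.\<close>

lemma (in bounded_bilinear) Ck_on:
  assumes "open S" "Ck_on k f S" "Ck_on k g S"
  shows "Ck_on k (\<lambda>x. prod (f x) (g x)) S"
  using assms(2,3)
proof (induction k arbitrary: f g)
  case 0
  then show ?case by (simp add: continuous_on)
next
  case (Suc k)
  show ?case
  proof (rule Ck_on_SucI[OF assms(1)])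
    fix x assume "x \<in> S"
    then show "((\<lambda>x. prod (f x) (g x)) has_derivative
        (\<lambda>h. prod (f x) (frechet_derivative g (at x) h) + prod (frechet_derivative f (at x) h) (g x))) (at x)"
      by (intro FDERIV Ck_on_Suc_derivative[OF Suc.prems(1)] Ck_on_Suc_derivative[OF Suc.prems(2)])
  next
    fix v
    show "Ck_on k (\<lambda>x. prod (f x) (frechet_derivative g (at x) v)
        + prod (frechet_derivative f (at x) v) (g x)) S"
      using Suc.prems
      by (intro Ck_on_add[OF assms(1)] Suc.IH Ck_on_Suc_imp[OF Suc.prems(1)] Ck_on_Suc_imp[OF Suc.prems(2)])
        auto
  qed
qed

lemma Ck_on_bounded_linear:
  assumes "bounded_linear L" "open S" "Ck_on k f S"
  shows "Ck_on k (\<lambda>x. L (f x)) S"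
  using assms(3)
proof (induction k arbitrary: f)
  case 0
  then show ?case by (simp add: bounded_linear.continuous_on[OF assms(1)])
next
  case (Suc k)
  show ?case
  proof (rule Ck_on_SucI[OF assms(2)])
    show "((\<lambda>x. L (f x)) has_derivative (\<lambda>h. L (frechet_derivative f (at x) h))) (at x)" if "x \<in> S" for x
      by (rule bounded_linear.has_derivative[OF assms(1) Ck_on_Suc_derivative[OF Suc.prems that]])
    show "Ck_on k (\<lambda>x. L (frechet_derivative f (at x) v)) S" for v
      by (rule Suc.IH) (use Suc.prems in simp)
  qed
qed

lemma Ck_on_diff:
  assumes "open S" "Ck_on k f S" "Ck_on k g S"
  shows "Ck_on k (\<lambda>x. f x - g x) S"
  using Ck_on_add[OF assms(1,2)
      Ck_on_bounded_linear[OF bounded_linear_minus[OF bounded_linear_ident] assms(1,3)]] by simp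

lemma Ck_on_prod:
  fixes f :: "'i \<Rightarrow> 'a::real_normed_vector \<Rightarrow> 'b::{real_normed_algebra_1,comm_monoid_mult}"
  assumes "open S" "\<And>i. i \<in> I \<Longrightarrow> Ck_on k (f i) S"
  shows "Ck_on k (\<lambda>x. \<Prod>i\<in>I. f i x) S"
  using assms(2)
  by (induction I rule: infinite_finite_induct)
    (auto simp: Ck_on_const bounded_bilinear.Ck_on[OF bounded_bilinear_mult assms(1)])

lemma Ck_on_compose:
  fixes f :: "'a::real_normed_vector \<Rightarrow> 'b::euclidean_space"
  assumes "open S" "open T" "f ` S \<subseteq> T" "Ck_on k f S" "Ck_on k g T"
  shows "Ck_on k (\<lambda>x. g (f x)) S"
  using assms(4,5)
proof (induction k arbitrary: g)
  case 0
  then show ?case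
    using assms(3) by (auto intro: continuous_on_compose2)
next
  case (Suc k)
  have Df: "(f has_derivative frechet_derivative f (at x)) (at x)" if "x \<in> S" for x
    using Ck_on_Suc_derivative[OF Suc.prems(1) that] .
  have Dg: "(g has_derivative frechet_derivative g (at y)) (at y)" if "y \<in> T" for y
    using Ck_on_Suc_derivative[OF Suc.prems(2) that] .
  show ?case
  proof (rule Ck_on_SucI[OF assms(1)])
    fix x assume x: "x \<in> S"
    then have y: "f x \<in> T" using assms(3) by auto
    have D: "((\<lambda>x. g (f x)) has_derivative (\<lambda>h. frechet_derivative g (at (f x)) (frechet_derivative f (at x) h))) (at x)"
      using diff_chain_at[OF Df[OF x] Dg[OF y]] by (simp add: o_def)
    \<comment> \<open>In the chain rule the direction fed to the derivative of \<open>g\<close>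
      varies with \<open>x\<close>, whereas \<open>Ck_on\<close> only speaks of fixed directions.
      Expanding in the basis of the intermediate Euclidean space turns the derivative into scalar
      C^k functions times derivatives of \<open>g\<close> in fixed directions, composed with
      \<open>f\<close>; the induction hypothesis covers the latter.\<close>
    have lin: "frechet_derivative g (at (f x)) w =
        (\<Sum>b\<in>Basis. (w \<bullet> b) *\<^sub>R frechet_derivative g (at (f x)) b)" for w
    proof -
      interpret linear "frechet_derivative g (at (f x))"
        using Dg[OF y] has_derivative_linear by blast
      have "frechet_derivative g (at (f x)) (\<Sum>b\<in>Basis. (w \<bullet> b) *\<^sub>R b) =
        (\<Sum>b\<in>Basis. (w \<bullet> b) *\<^sub>R frechet_derivative g (at (f x)) b)"
        by (simp add: sum scale)
      then show ?thesis by (simp add: euclidean_representation)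
    qed
    show "((\<lambda>x. g (f x)) has_derivative (\<lambda>h. \<Sum>b\<in>Basis.
        (frechet_derivative f (at x) h \<bullet> b) *\<^sub>R frechet_derivative g (at (f x)) b)) (at x)"
      by (rule has_derivative_eq_rhs[OF D]) (rule ext, rule lin)
  next
    fix v
    show "Ck_on k (\<lambda>x. \<Sum>b\<in>Basis. (frechet_derivative f (at x) v \<bullet> b) *\<^sub>R frechet_derivative g (at (f x)) b) S"
    proof (intro Ck_on_sum[OF assms(1)] bounded_bilinear.Ck_on[OF bounded_bilinear_scaleR assms(1)])
      fix b :: 'b
      show "Ck_on k (\<lambda>x. frechet_derivative f (at x) v \<bullet> b) S"
        using Suc.prems(1) by (intro Ck_on_bounded_linear[OF bounded_linear_inner_left assms(1)]) auto
      show "Ck_on k (\<lambda>x. frechet_derivative g (at (f x)) b) S"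
        using Suc.prems by (intro Suc.IH Ck_on_Suc_imp[OF Suc.prems(1)]) auto
    qed
  qed
qed

section \<open>A smooth inverse function theorem\<close>

text \<open>An operator on a Euclidean space is the finite sum over the basis of the rank-one
  operators u \<mapsto> (u \<bullet> b) A(b), and each of these depends linearly on the value
  A(b).\<close>

lemma Ck_on_blinfun:
  fixes A :: "'a::real_normed_vector \<Rightarrow> 'b::euclidean_space \<Rightarrow>\<^sub>L 'c::real_normed_vector"
  assumes "open S" "\<And>b. b \<in> Basis \<Longrightarrow> Ck_on k (\<lambda>x. blinfun_apply (A x) b) S"
  shows "Ck_on k A S"
proof -
  have repr: "A x = (\<Sum>b\<in>Basis. blinfun_scaleR_left (A x b) o\<^sub>L blinfun_inner_right b)" for x
  proof (rule blinfun_eqI)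
    fix u
    have "blinfun_apply (A x) (\<Sum>b\<in>Basis. (u \<bullet> b) *\<^sub>R b) = (\<Sum>b\<in>Basis. (u \<bullet> b) *\<^sub>R A x b)"
      by (simp add: blinfun.sum_right blinfun.scaleR_right)
    then show "A x u = (\<Sum>b\<in>Basis. blinfun_scaleR_left (A x b) o\<^sub>L blinfun_inner_right b) u"
      unfolding euclidean_representation by (simp add: blinfun.sum_left inner_commute)
  qed
  have lin: "bounded_linear (\<lambda>w::'c. blinfun_scaleR_left w o\<^sub>L blinfun_inner_right (b::'b))" for b
    by (intro bounded_linear_compose[OF
        bounded_bilinear.bounded_linear_left[OF bounded_bilinear_blinfun_compose]])
       (simp add: bounded_linear_blinfun_scaleR_left)
  have "Ck_on k (\<lambda>x. \<Sum>b\<in>Basis. blinfun_scaleR_left (A x b) o\<^sub>L blinfun_inner_right b) S"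
    by (rule Ck_on_sum[OF assms(1)], rule Ck_on_bounded_linear[OF lin assms(1)], rule assms(2))
  then show ?thesis by (rule Ck_on_cong[OF assms(1)]) (rule repr[symmetric])
qed

section \<open>Regularity of operator inversion, from the resolvent identity\<close>

lemma blinfun_inverse_diff:
  fixes A B S T :: "'a::real_normed_vector \<Rightarrow>\<^sub>L 'a"
  assumes "S o\<^sub>L A = id_blinfun" "B o\<^sub>L T = id_blinfun"
  shows "S - T = S o\<^sub>L (B - A) o\<^sub>L T"
proof (rule blinfun_eqI)
  fix v
  have "S (A w) = w" "B (T w) = w" for w
    using assms by (metis blinfun_apply_blinfun_compose blinfun_apply_id_blinfun id_apply)+
  then show "(S - T) v = (S o\<^sub>L (B - A) o\<^sub>L T) v"
    by (simp add: blinfun.diff_left blinfun.diff_right)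
qed

lemma blinfun_inverse_continuous_on:
  fixes A T :: "'a::real_normed_vector \<Rightarrow> 'b::real_normed_vector \<Rightarrow>\<^sub>L 'b"
  assumes "continuous_on S A"
    and TA: "\<And>x. x \<in> S \<Longrightarrow> T x o\<^sub>L A x = id_blinfun"
    and AT: "\<And>x. x \<in> S \<Longrightarrow> A x o\<^sub>L T x = id_blinfun"
  shows "continuous_on S T"
  unfolding continuous_on_def
proof
  fix x assume x: "x \<in> S"
  let ?F = "at x within S"
  have lim: "((\<lambda>y. norm (A x - A y)) \<longlongrightarrow> 0) ?F"
  proof -
    have "(A \<longlongrightarrow> A x) ?F" using assms(1) x by (simp add: continuous_on_def)
    then have "((\<lambda>y. norm (A x - A y)) \<longlongrightarrow> norm (A x - A x)) ?F"
      by (intro tendsto_intros)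
    then show ?thesis by simp
  qed
  then have "((\<lambda>y. norm (A x - A y) * norm (T x)) \<longlongrightarrow> 0) ?F"
    by (rule tendsto_mult_left_zero)
  then have "\<forall>\<^sub>F y in ?F. norm (A x - A y) * norm (T x) < 1/2"
    by (rule order_tendstoD) simp
  moreover have "\<forall>\<^sub>F y in ?F. y \<in> S" by (simp add: eventually_at_topological) blast
  ultimately have "\<forall>\<^sub>F y in ?F. norm (T y - T x) \<le> 2 * norm (T x) * norm (T x) * norm (A x - A y)"
  proof eventually_elim
    case (elim y)
    define e where "e = norm (A x - A y)"
    define s where "s = norm (T y)"
    define t where "t = norm (T x)"
    have "norm (T y - T x) \<le> norm (T y o\<^sub>L (A x - A y)) * norm (T x)"
      unfolding blinfun_inverse_diff[OF TA[OF elim(2)] AT[OF x]] by (rule norm_blinfun_compose)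
    also have "\<dots> \<le> (s * e) * t"
      unfolding e_def t_def s_def by (intro mult_right_mono norm_blinfun_compose) auto
    finally have 1: "norm (T y - T x) \<le> s * (e * t)" by (simp add: mult.assoc)
    have "s * (e * t) \<le> s * (1/2)"
      by (intro mult_left_mono) (use elim in \<open>auto simp: s_def e_def t_def\<close>)
    moreover have "s - t \<le> norm (T y - T x)" unfolding s_def t_def by (rule norm_triangle_ineq2)
    \<comment> \<open>The resolvent identity bounds s - t by s/2, which is what the threshold 1/2
      was chosen for. So the inverses are bounded near \<open>x\<close>, and inserting this into the
      identity again gives a bound linear in \<open>norm (A x - A y)\<close>.\<close>
    ultimately have "s \<le> 2 * t" using 1 by linarith
    then have "s * (e * t) \<le> (2 * t) * (e * t)"
      by (intro mult_right_mono) (auto simp: e_def t_def)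
    with 1 show ?case unfolding e_def t_def by (simp add: mult_ac)
  qed
  then have "((\<lambda>y. T y - T x) \<longlongrightarrow> 0) ?F"
    by (rule Lim_null_comparison) (rule tendsto_mult_right_zero[OF lim])
  then show "(T \<longlongrightarrow> T x) ?F" by (rule LIM_zero_cancel)
qed

text \<open>Because \<open>g x = 0\<close>, continuity of \<open>f\<close> suffices: the remainder
  splits into \<open>p (f y)\<close> applied to the remainder of \<open>g\<close>, plus
  \<open>p (f y - f x)\<close> applied to the linear part of \<open>g\<close>. Divided by
  \<open>norm (y - x)\<close>, the first is a convergent factor times a null one, the second a null
  factor times a bounded one.\<close>

lemma has_derivative_bilinear_vanishing:
  assumes "bounded_bilinear p" "continuous (at x) f" "(g has_derivative g') (at x)" "g x = 0"
  shows "((\<lambda>y. p (f y) (g y)) has_derivative (\<lambda>h. p (f x) (g' h))) (at x)"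
proof -
  interpret bounded_bilinear p by fact
  interpret g': bounded_linear g' using assms(3) by (rule has_derivative_bounded_linear)
  let ?q = "\<lambda>y. (g y - g' (y - x)) /\<^sub>R norm (y - x)"
  have 1: "(?q \<longlongrightarrow> 0) (at x)"
    using assms(3,4) by (simp add: has_derivative_at_within diff_diff_eq algebra_simps)
  have 2: "((\<lambda>y. f y - f x) \<longlongrightarrow> 0) (at x)"
    using assms(2) by (simp add: continuous_at LIM_zero)
  obtain K where K: "\<And>h. norm (g' h) \<le> norm h * K" using g'.bounded by blast
  have "Bfun (\<lambda>y. g' (y - x) /\<^sub>R norm (y - x)) (at x)"
  proof (rule BfunI[where K = K])
    show "\<forall>\<^sub>F y in at x. norm (g' (y - x) /\<^sub>R norm (y - x)) \<le> K"
      unfolding eventually_at_filter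
    proof (intro always_eventually allI impI)
      fix y assume "y \<noteq> x"
      then show "norm (g' (y - x) /\<^sub>R norm (y - x)) \<le> K"
        using K[of "y - x"] by (simp add: field_simps)
    qed
  qed
  then have 3: "((\<lambda>y. p (f y - f x) (g' (y - x) /\<^sub>R norm (y - x))) \<longlongrightarrow> 0) (at x)"
    using 2 Zfun_prod_Bfun by (simp add: tendsto_Zfun_iff)
  have 4: "((\<lambda>y. p (f y) (?q y)) \<longlongrightarrow> 0) (at x)"
    using tendsto[OF _ 1] assms(2) by (fastforce simp: continuous_at zero_right)
  have "((\<lambda>y. p (f y) (?q y) + p (f y - f x) (g' (y - x) /\<^sub>R norm (y - x))) \<longlongrightarrow> 0) (at x)"
    using tendsto_add[OF 4 3] by simp
  also have "(\<lambda>y. p (f y) (?q y) + p (f y - f x) (g' (y - x) /\<^sub>R norm (y - x))) =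
     (\<lambda>y. (p (f y) (g y) - p (f x) (g x) - p (f x) (g' (y - x))) /\<^sub>R norm (y - x))"
    using assms(4) by (auto simp: fun_eq_iff scaleR_right diff_left diff_right zero_right algebra_simps)
  finally show ?thesis
    unfolding has_derivative_at_within
    by (simp add: bounded_linear_compose[OF bounded_linear_right g'.bounded_linear_axioms])
qed

text \<open>The resolvent identity reads T(y) = T(x) + T(y) (A(x) - A(y)) T(x). The middle factor
  vanishes at y = x, so the unknown T(y) on the right need only be continuous there.\<close>

lemma blinfun_inverse_has_derivative:
  fixes A T :: "'a::real_normed_vector \<Rightarrow> 'b::real_normed_vector \<Rightarrow>\<^sub>L 'b"
  assumes "open S" "x \<in> S" "(A has_derivative A') (at x)" "continuous_on S T"
    and TA: "\<And>x. x \<in> S \<Longrightarrow> T x o\<^sub>L A x = id_blinfun"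
    and AT: "\<And>x. x \<in> S \<Longrightarrow> A x o\<^sub>L T x = id_blinfun"
  shows "(T has_derivative (\<lambda>h. - (T x o\<^sub>L A' h o\<^sub>L T x))) (at x)"
proof -
  have cont: "continuous (at x) T"
    using assms by (simp add: continuous_on_eq_continuous_at)
  have D: "((\<lambda>y. T y o\<^sub>L (A x - A y)) has_derivative (\<lambda>h. T x o\<^sub>L (- A' h))) (at x)"
    by (rule has_derivative_bilinear_vanishing[OF bounded_bilinear_blinfun_compose cont])
      (auto intro!: derivative_eq_intros assms(3))
  have "((\<lambda>y. T x + ((T y o\<^sub>L (A x - A y)) o\<^sub>L T x)) has_derivative (\<lambda>h. (T x o\<^sub>L (- A' h)) o\<^sub>L T x)) (at x)"
    using has_derivative_add[OF has_derivative_const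
        bounded_linear.has_derivative[OF bounded_bilinear.bounded_linear_left[OF bounded_bilinear_blinfun_compose] D]]
    by simp
  moreover have "T x + ((T y o\<^sub>L (A x - A y)) o\<^sub>L T x) = T y" if "y \<in> S" for y
    using blinfun_inverse_diff[OF TA[OF that] AT[OF assms(2)]] by (simp add: algebra_simps)
  ultimately have "(T has_derivative (\<lambda>h. (T x o\<^sub>L (- A' h)) o\<^sub>L T x)) (at x)"
    using has_derivative_transform_within_open[OF _ assms(1,2)] by blast
  moreover have "(T x o\<^sub>L (- A' h)) o\<^sub>L T x = - (T x o\<^sub>L A' h o\<^sub>L T x)" for h
    by (simp add: blinfun_eqI blinfun.minus_left blinfun.minus_right)
  ultimately show ?thesis by simp
qed

text \<open>Bootstrapping: the derivative of \<open>T\<close> is a product of \<open>T\<close>, the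
  derivative of \<open>A\<close> and \<open>T\<close>, so it is C^k as soon as \<open>T\<close> is,
  which makes \<open>T\<close> C^(k+1).\<close>

lemma Ck_on_blinfun_inverse:
  fixes A T :: "'a::real_normed_vector \<Rightarrow> 'b::real_normed_vector \<Rightarrow>\<^sub>L 'b"
  assumes "open S" "Ck_on k A S"
    and TA: "\<And>x. x \<in> S \<Longrightarrow> T x o\<^sub>L A x = id_blinfun"
    and AT: "\<And>x. x \<in> S \<Longrightarrow> A x o\<^sub>L T x = id_blinfun"
  shows "Ck_on k T S"
  using assms(2)
proof (induction k)
  case 0
  then show ?case using blinfun_inverse_continuous_on[OF _ TA AT] by simp
next
  case (Suc k)
  have T: "Ck_on k T S" using Suc Ck_on_Suc_imp by blast
  show ?case
  proof (rule Ck_on_SucI[OF assms(1)])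
    show "(T has_derivative (\<lambda>h. - (T x o\<^sub>L frechet_derivative A (at x) h o\<^sub>L T x))) (at x)" if "x \<in> S" for x
      by (rule blinfun_inverse_has_derivative[OF assms(1) that _ Ck_on_continuous[OF T] TA AT])
        (use Ck_on_Suc_derivative[OF Suc.prems that] in auto)
    show "Ck_on k (\<lambda>x. - (T x o\<^sub>L frechet_derivative A (at x) v o\<^sub>L T x)) S" for v
      using Suc.prems
      by (intro Ck_on_bounded_linear[OF bounded_linear_minus[OF bounded_linear_ident] assms(1)]
           bounded_bilinear.Ck_on[OF bounded_bilinear_blinfun_compose assms(1)] T) auto
  qed
qed

text \<open>The C^1 theorem supplies the local inverse \<open>g\<close> together with its
  derivative, the inverse operator of \<open>f'\<close> at \<open>g y\<close>. Smoothness of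
  operator inversion then raises the regularity of \<open>g\<close> order by order.\<close>

theorem smooth_inverse_function_theorem:
  fixes f :: "'a::euclidean_space \<Rightarrow> 'a"
  assumes "open S" "x0 \<in> S" and smooth: "\<And>k. Ck_on k f S"
    and inj: "inj (frechet_derivative f (at x0))"
  obtains U V g where "open U" "x0 \<in> U" "U \<subseteq> S" "open V" "homeomorphism U V f g" "\<And>k. Ck_on k g V"
proof -
  define f' where "f' = (\<lambda>x. Blinfun (frechet_derivative f (at x)))"
  have D: "(f has_derivative frechet_derivative f (at x)) (at x)" if "x \<in> S" for x
    using Ck_on_Suc_derivative[OF smooth that] .
  have f': "blinfun_apply (f' x) = frechet_derivative f (at x)" if "x \<in> S" for x
    unfolding f'_def using D[OF that] bounded_linear_Blinfun_apply has_derivative_bounded_linear by blast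
  have Ckf': "Ck_on k f' S" for k
  proof (rule Ck_on_blinfun[OF assms(1)])
    fix b
    show "Ck_on k (\<lambda>x. blinfun_apply (f' x) b) S"
      by (rule Ck_on_cong[OF assms(1), of _ "\<lambda>x. frechet_derivative f (at x) b"])
        (use smooth[of "Suc k"] f' in auto)
  qed
  \<comment> \<open>In finite dimension injectivity already yields a linear left inverse of the
    derivative, the form in which the C^1 theorem takes invertibility.\<close>
  obtain h where "linear h" "h \<circ> frechet_derivative f (at x0) = id"
    using linear_injective_left_inverse[OF has_derivative_linear[OF D[OF assms(2)]] inj] by blast
  then have inv: "Blinfun h o\<^sub>L f' x0 = id_blinfun"
    using f'[OF assms(2)]
    by (intro blinfun_eqI)
      (simp add: bounded_linear_Blinfun_apply linear_conv_bounded_linear pointfree_idE)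
  obtain U V g g' where UV: "open U" "U \<subseteq> S" "x0 \<in> U" "open V" "homeomorphism U V f g"
    and g: "\<And>y. y \<in> V \<Longrightarrow> (g has_derivative (g' y)) (at y)"
      "\<And>y. y \<in> V \<Longrightarrow> g' y = inv_into UNIV (blinfun_apply (f' (g y)))"
      "\<And>y. y \<in> V \<Longrightarrow> bij (blinfun_apply (f' (g y)))"
  proof (rule inverse_function_theorem[OF assms(1) _ Ck_on_continuous[OF Ckf'] assms(2) inv])
    show "(f has_derivative blinfun_apply (f' x)) (at x)" if "x \<in> S" for x
      using D f' that by simp
  qed (rule that, assumption+)
  define T where "T = (\<lambda>x. Blinfun (inv_into UNIV (blinfun_apply (f' x))))"
  have gV: "g ` V = U" "f ` U = V" "\<And>x. x \<in> U \<Longrightarrow> g (f x) = x"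
    using UV(5) by (auto simp: homeomorphism_def)
  have bij: "bij (blinfun_apply (f' x))" if "x \<in> U" for x
    using g(3)[of "f x"] gV that by auto
  \<comment> \<open>\<open>Blinfun\<close> is only meaningful on bounded linear maps; the inverse is
    one because it is the derivative of \<open>g\<close> at \<open>f x\<close>.\<close>
  have T: "blinfun_apply (T x) = inv_into UNIV (blinfun_apply (f' x))" if "x \<in> U" for x
  proof -
    have "(g has_derivative inv_into UNIV (blinfun_apply (f' x))) (at (f x))"
      using g(1,2)[of "f x"] gV that by auto
    then show ?thesis
      unfolding T_def using bounded_linear_Blinfun_apply has_derivative_bounded_linear by blast
  qed
  have TC: "Ck_on k T U" for k
  proof (rule Ck_on_blinfun_inverse[OF UV(1) Ck_on_subset[OF Ckf' UV(2)]])
    fix x assume "x \<in> U"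
    with bij T show "T x o\<^sub>L f' x = id_blinfun" "f' x o\<^sub>L T x = id_blinfun"
      by (auto intro!: blinfun_eqI simp: bij_is_inj bij_is_surj surj_f_inv_f)
  qed
  \<comment> \<open>The derivative of \<open>g\<close> is \<open>T\<close> composed with
    \<open>g\<close>; as \<open>T\<close> is smooth, a C^k map \<open>g\<close> has a C^k
    derivative.\<close>
  have "Ck_on k g V" for k
  proof (induction k)
    case 0
    then show ?case using UV(5) by (simp add: homeomorphism_def)
  next
    case (Suc k)
    show ?case
    proof (rule Ck_on_SucI[OF UV(4)])
      show "(g has_derivative (\<lambda>v. blinfun_apply (T (g y)) v)) (at y)" if "y \<in> V" for y
        using g(1,2)[OF that] T gV that by auto
      show "Ck_on k (\<lambda>y. blinfun_apply (T (g y)) v) V" for v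
        by (intro Ck_on_bounded_linear[OF blinfun.bounded_linear_left UV(4)]
            Ck_on_compose[OF UV(4,1) _ Suc TC]) (use gV in auto)
    qed
  qed
  with UV that show ?thesis by blast
qed

section \<open>A chart of the special unitary group at the identity\<close>

lemma bounded_bilinear_matrix_mult:
  "bounded_bilinear ((**) :: complex^'n^'n \<Rightarrow> complex^'n^'n \<Rightarrow> complex^'n^'n)"
  unfolding bilinear_conv_bounded_bilinear[symmetric] bilinear_def
  by (auto intro!: linearI simp: matrix_matrix_mult_def vec_eq_iff ring_distribs sum.distrib scaleR_sum_right)

interpretation mmult: bounded_bilinear "(**) :: complex^'n^'n \<Rightarrow> complex^'n^'n \<Rightarrow> complex^'n^'n"
  by (rule bounded_bilinear_matrix_mult)

lemma bounded_linear_adjoint_matrix: "bounded_linear (adjoint_matrix :: complex^'n^'n \<Rightarrow> _)"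
  unfolding linear_conv_bounded_linear[symmetric]
  by (auto intro!: linearI simp: adjoint_matrix_def vec_eq_iff)

lemmas adjoint_matrix_add = linear_add[OF bounded_linear.linear[OF bounded_linear_adjoint_matrix]]
lemmas adjoint_matrix_diff = linear_diff[OF bounded_linear.linear[OF bounded_linear_adjoint_matrix]]
lemmas adjoint_matrix_scaleR = linear_scale[OF bounded_linear.linear[OF bounded_linear_adjoint_matrix]]
lemmas adjoint_matrix_zero = linear_0[OF bounded_linear.linear[OF bounded_linear_adjoint_matrix]]

lemma adjoint_matrix_mat [simp]: "adjoint_matrix (mat c) = mat (cnj c)"
  by (simp add: adjoint_matrix_def mat_def vec_eq_iff)

lemma bounded_linear_trace: "bounded_linear (trace :: complex^'n^'n \<Rightarrow> complex)"
  unfolding linear_conv_bounded_linear[symmetric]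
  by (auto intro!: linearI simp: trace_def sum.distrib scaleR_sum_right)

lemmas trace_scaleR = linear_scale[OF bounded_linear.linear[OF bounded_linear_trace]]
lemmas trace_zero = linear_0[OF bounded_linear.linear[OF bounded_linear_trace]]

lemma trace_mat: "trace (mat c :: complex^'n^'n) = of_nat CARD('n) * c"
  by (simp add: trace_def mat_def)

lemma trace_adjoint_matrix: "trace (adjoint_matrix A) = cnj (trace A)"
  by (simp add: trace_def adjoint_matrix_def)

lemma det_adjoint_matrix: "det (adjoint_matrix A) = cnj (det A)"
proof -
  have "det (adjoint_matrix A) = det (transpose (\<chi> i j. cnj (A $ i $ j)))"
    by (simp add: adjoint_matrix_def transpose_def)
  also have "\<dots> = cnj (det A)"
    by (simp only: det_transpose) (simp add: det_def)
  finally show ?thesis .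
qed

lemma mat_commute: "mat c ** (B :: complex^'n^'n) = B ** mat c"
  by (simp add: mat_def matrix_matrix_mult_def vec_eq_iff if_distrib if_distribR cong: if_cong)

lemma det_mat: "det (mat c :: complex^'n^'n) = c ^ CARD('n)"
  by (subst det_diagonal) (simp_all add: mat_def)

lemma bounded_linear_mat_imaginary:
  "bounded_linear (\<lambda>r. mat (\<i> * complex_of_real r) :: complex^'n^'n)"
  unfolding linear_conv_bounded_linear[symmetric]
  by (auto intro!: linearI simp: mat_def vec_eq_iff ring_distribs complex_eq_iff)

section \<open>Smoothness of the determinant and its derivative at the identity\<close>

lemma Ck_on_det: "Ck_on k (det :: complex^'n^'n \<Rightarrow> complex) UNIV"
proof -
  have lin: "bounded_linear (\<lambda>A :: complex^'n^'n. A $ i $ j)" for i j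
    by (intro bounded_linear_compose[OF bounded_linear_vec_nth bounded_linear_vec_nth])
  have "Ck_on k (\<lambda>A :: complex^'n^'n. \<Sum>p\<in>{p. p permutes UNIV}. of_int (sign p) * (\<Prod>i\<in>UNIV. A $ i $ p i)) UNIV"
    by (intro Ck_on_sum bounded_bilinear.Ck_on[OF bounded_bilinear_mult] Ck_on_const Ck_on_prod
        Ck_on_linear lin open_UNIV)
  then show ?thesis by (simp add: det_def[abs_def])
qed

lemma has_derivative_det:
  "((det :: complex^'n^'n \<Rightarrow> complex) has_derivative frechet_derivative det (at A)) (at A)"
  by (rule Ck_on_Suc_derivative[OF Ck_on_det]) simp

text \<open>Along the line t \<mapsto> (1 + it) 1 the determinant is the power (1 + it)^n, which can
  be differentiated directly. This one direction is enough later, since the possible kernel of the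
  derivative of \<open>SU_coord\<close> consists of imaginary scalar matrices.\<close>

lemma frechet_derivative_det_mat:
  "frechet_derivative det (at (mat 1)) (mat \<i> :: complex^'n^'n) = of_nat CARD('n) * \<i>"
proof -
  have "((\<lambda>t::real. mat (1 + \<i> * of_real t) :: complex^'n^'n) has_derivative (\<lambda>h. mat (\<i> * of_real h))) (at 0)"
  proof -
    have "((\<lambda>t::real. mat 1 + mat (\<i> * of_real t) :: complex^'n^'n) has_derivative (\<lambda>h. mat (\<i> * of_real h))) (at 0)"
      using has_derivative_add[OF has_derivative_const
          bounded_linear_imp_has_derivative[OF bounded_linear_mat_imaginary]] by simp
    moreover have "mat 1 + mat (\<i> * of_real t) = (mat (1 + \<i> * of_real t) :: complex^'n^'n)" for t
      by (simp add: mat_def vec_eq_iff)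
    ultimately show ?thesis by simp
  qed
  from diff_chain_at[OF this, of det "frechet_derivative det (at (mat 1))"] has_derivative_det[of "mat 1 :: complex^'n^'n"]
  have "((\<lambda>t::real. (1 + \<i> * of_real t) ^ CARD('n)) has_derivative
      (\<lambda>h. frechet_derivative det (at (mat 1)) (mat (\<i> * of_real h) :: complex^'n^'n))) (at 0)"
    by (simp add: o_def det_mat)
  moreover have "((\<lambda>t::real. (1 + \<i> * of_real t) ^ CARD('n)) has_derivative
      (\<lambda>h. of_nat CARD('n) * \<i> * of_real h)) (at 0)"
    by (auto intro!: derivative_eq_intros)
  ultimately have "(\<lambda>h::real. frechet_derivative det (at (mat 1)) (mat (\<i> * of_real h) :: complex^'n^'n))
      = (\<lambda>h. of_nat CARD('n) * \<i> * of_real h)"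
    by (rule has_derivative_unique)
  from fun_cong[OF this, of 1] show ?thesis by simp
qed

text \<open>The last summand replaces the trace \<open>\<i> Im (tr A)\<close> of the skew-Hermitian part of \<open>A\<close> by
  \<open>\<i> Im (det A)\<close>, which agrees with it to first order at \<open>1\<close>.\<close>

definition SU_coord :: "complex^'n^'n \<Rightarrow> complex^'n^'n" where
  "SU_coord A = (1/2) *\<^sub>R (A - adjoint_matrix A) + (1/2) *\<^sub>R (adjoint_matrix A ** A - mat 1)
     + mat (\<i> * of_real ((Im (det A) - Im (trace A)) / of_nat CARD('n)))"

definition su_algebra :: "(complex^'n^'n) set" where
  "su_algebra = {X. adjoint_matrix X = - X \<and> trace X = 0}"

lemma Ck_on_SU_coord: "Ck_on k (SU_coord :: complex^'n^'n \<Rightarrow> _) UNIV"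
proof -
  have lin: "Ck_on k (\<lambda>A :: complex^'n^'n. (1/2) *\<^sub>R (A - adjoint_matrix A)) UNIV"
    by (intro Ck_on_linear bounded_linear_const_scaleR bounded_linear_sub bounded_linear_ident
        bounded_linear_adjoint_matrix)
  have "Ck_on k (\<lambda>A :: complex^'n^'n. adjoint_matrix A ** A - mat 1) UNIV"
    by (rule Ck_on_diff[OF open_UNIV mmult.Ck_on[OF open_UNIV
          Ck_on_linear[OF bounded_linear_adjoint_matrix] Ck_on_linear[OF bounded_linear_ident]] Ck_on_const])
  note quadratic = Ck_on_bounded_linear[OF bounded_linear_scaleR_right open_UNIV this]
  have "Ck_on k (\<lambda>A :: complex^'n^'n. Im (det A) - Im (trace A)) UNIV"
    by (rule Ck_on_diff[OF open_UNIV Ck_on_bounded_linear[OF bounded_linear_Im open_UNIV Ck_on_det]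
          Ck_on_linear[OF bounded_linear_compose[OF bounded_linear_Im bounded_linear_trace]]])
  note scalar = Ck_on_bounded_linear[OF bounded_linear_compose[OF bounded_linear_mat_imaginary
        bounded_linear_divide] open_UNIV this]
  show ?thesis
    unfolding SU_coord_def[abs_def]
    by (rule Ck_on_add[OF open_UNIV Ck_on_add[OF open_UNIV lin quadratic] scalar])
qed

lemma inj_frechet_derivative_SU_coord:
  "inj (frechet_derivative SU_coord (at (mat 1 :: complex^'n^'n)))"
proof -
  define D where "D = frechet_derivative det (at (mat 1 :: complex^'n^'n))"
  let ?r = "\<lambda>H. (Im (D H) - Im (trace H)) / of_nat CARD('n)"
  have D: "(det has_derivative D) (at (mat 1))"
    unfolding D_def by (rule has_derivative_det)
  interpret D: bounded_linear D using D by (rule has_derivative_bounded_linear)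
  have "(SU_coord has_derivative (\<lambda>H. (1/2) *\<^sub>R (H - adjoint_matrix H) +
      (1/2) *\<^sub>R (adjoint_matrix (mat 1) ** H + adjoint_matrix H ** mat 1 - 0) + mat (\<i> * of_real (?r H)))) (at (mat 1))"
    unfolding SU_coord_def[abs_def]
    by (intro has_derivative_add has_derivative_scaleR_right has_derivative_diff has_derivative_ident
        has_derivative_const mmult.FDERIV D bounded_linear.has_derivative[OF bounded_linear_divide]
        bounded_linear.has_derivative[OF bounded_linear_adjoint_matrix]
        bounded_linear.has_derivative[OF bounded_linear_mat_imaginary]
        bounded_linear.has_derivative[OF bounded_linear_trace]
        bounded_linear.has_derivative[OF bounded_linear_Im])
  moreover have "(1/2) *\<^sub>R (H - adjoint_matrix H) +
      (1/2) *\<^sub>R (adjoint_matrix (mat 1) ** H + adjoint_matrix H ** mat 1 - 0) = H" for H :: "complex^'n^'n"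
    by (simp add: scaleR_add_right[symmetric] del: scaleR_add_right)
  ultimately have F: "frechet_derivative SU_coord (at (mat 1)) = (\<lambda>H. H + mat (\<i> * of_real (?r H)))"
    using frechet_derivative_at by force
  have "SU_coord differentiable (at (mat 1 :: complex^'n^'n))"
    by (rule differentiableI, rule Ck_on_Suc_derivative[OF Ck_on_SU_coord UNIV_I])
  note linF = linear_frechet_derivative[OF this]
  have "H = 0" if "frechet_derivative SU_coord (at (mat 1)) H = 0" for H :: "complex^'n^'n"
  proof -
    define r where "r = ?r H"
    have H: "H = mat (\<i> * of_real (- r))"
      using that unfolding F r_def[symmetric] by (simp add: eq_neg_iff_add_eq_0[symmetric] mat_def vec_eq_iff)
    also have "\<dots> = (- r) *\<^sub>R mat \<i>"
      by (simp add: mat_def vec_eq_iff complex_eq_iff)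
    finally have "D H = (- r) *\<^sub>R (of_nat CARD('n) * \<i>)"
      using D.scaleR frechet_derivative_det_mat unfolding D_def by metis
    moreover have "trace H = (- r) *\<^sub>R (of_nat CARD('n) * \<i>)"
      by (subst H) (simp add: trace_mat scaleR_conv_of_real)
    ultimately have "r = 0" unfolding r_def by simp
    then show ?thesis using H by (simp add: mat_def vec_eq_iff)
  qed
  then show ?thesis using linear_injective_0[OF linF] by blast
qed

text \<open>Writing F for \<open>SU_coord\<close>, F(A)* + F(A) = A*A - 1, so being skew-Hermitian
  is exactly unitarity. Once that holds the quadratic term drops out and the scalar correction makes
  the trace equal to i Im(det A).\<close>

lemma SU_coord_mem_su_algebra:
  fixes A :: "complex^'n^'n"
  shows "SU_coord A \<in> su_algebra \<longleftrightarrow> adjoint_matrix A ** A = mat 1 \<and> Im (det A) = 0"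
proof -
  let ?H = "adjoint_matrix A ** A - mat 1"
  define z where "z = \<i> * complex_of_real ((Im (det A) - Im (trace A)) / of_nat CARD('n))"
  have coord: "SU_coord A = (1/2) *\<^sub>R (A - adjoint_matrix A) + (1/2) *\<^sub>R ?H + mat z"
    by (simp add: SU_coord_def z_def)
  have z: "mat (cnj z) = - (mat z :: complex^'n^'n)" by (simp add: z_def mat_def vec_eq_iff)
  have H: "adjoint_matrix ?H = ?H"
    by (simp add: adjoint_matrix_diff adjoint_matrix_mult)
  have "adjoint_matrix (SU_coord A) = - SU_coord A + ?H"
    unfolding coord adjoint_matrix_add adjoint_matrix_scaleR adjoint_matrix_mat H z
      adjoint_matrix_diff[of A] adjoint_matrix_adjoint
    by (simp add: vec_eq_iff complex_eq_iff field_simps)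
  then have skew: "adjoint_matrix (SU_coord A) = - SU_coord A \<longleftrightarrow> adjoint_matrix A ** A = mat 1"
    by simp
  have "trace (SU_coord A) = \<i> * of_real (Im (det A))" if "adjoint_matrix A ** A = mat 1"
  proof -
    have "trace (SU_coord A) = (1/2) *\<^sub>R (trace A - cnj (trace A)) + of_nat CARD('n) * z"
      unfolding coord that by (simp add: trace_add trace_sub trace_scaleR trace_mat trace_adjoint_matrix)
    also have "\<dots> = \<i> * of_real (Im (det A))"
      by (simp add: z_def complex_diff_cnj field_simps scaleR_conv_of_real)
    finally show ?thesis .
  qed
  with skew show ?thesis by (auto simp: su_algebra_def)
qed

text \<open>A unitary matrix has determinant of modulus one; being real leaves 1 and -1, and the
  sign condition, valid near the identity, excludes -1.\<close>

lemma det_unitary_eq_1: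
  assumes "adjoint_matrix A ** A = mat 1" "Im (det A) = 0" "Re (det A) > 0"
  shows "det A = 1"
proof -
  have "cnj (det A) * det A = 1"
    using assms(1) by (metis det_I det_adjoint_matrix det_mul)
  moreover have "cnj (det A) = det A" using assms(2) by (simp add: complex_eq_iff)
  ultimately have "(Re (det A))\<^sup>2 = 1" using assms(2) by (simp add: complex_eq_iff power2_eq_square)
  with assms(2,3) show ?thesis by (simp add: complex_eq_iff power2_eq_1_iff)
qed

text \<open>With C = SB - BS, commutation of S^2 with B says SC + CS = 0. Putting S = 1 + E gives 2C
  = -(EC + CE), hence norm C \<le> K norm E norm C, and K norm E < 1 forces C = 0. The smallness
  condition does not involve \<open>B\<close>.\<close>

lemma commute_square_root:
  fixes S B :: "complex^'n^'n"
  assumes K: "\<And>X Y. norm ((X :: complex^'n^'n) ** (Y :: complex^'n^'n)) \<le> norm X * norm Y * K"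
    and S: "norm (S - mat 1) * K < 1"
    and sq: "(S ** S) ** B = B ** (S ** S)"
  shows "S ** B = B ** S"
proof -
  define C where "C = S ** B - B ** S"
  define E where "E = S - mat 1"
  have "S ** C + C ** S = 0"
    using sq unfolding C_def by (simp add: mmult.diff_left mmult.diff_right matrix_mul_assoc)
  moreover have "S = E + mat 1" by (simp add: E_def)
  ultimately have "(E ** C + C ** E) + 2 *\<^sub>R C = 0"
    by (simp add: mmult.add_left mmult.add_right scaleR_2 algebra_simps)
  then have "2 * norm C = norm (E ** C + C ** E)"
    by (metis add_eq_0_iff2 norm_minus_cancel norm_scaleR abs_numeral)
  also have "\<dots> \<le> norm E * norm C * K + norm C * norm E * K"
    by (intro norm_triangle_le add_mono K)
  finally have "norm C * (1 - norm E * K) \<le> 0" by (simp add: algebra_simps)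
  with S have "norm C \<le> 0" by (simp add: E_def mult_le_0_iff)
  then show ?thesis by (simp add: C_def)
qed

text \<open>Multiply \<open>A ** B = B ** A\<close> by A* on both sides and cancel. This serves both
  for inverses in the commutant and for the skew-Hermitian part of a commuting unitary
  matrix.\<close>

lemma adjoint_matrix_commute:
  fixes A :: "complex^'n^'n"
  assumes "unitary_matrix A" "A ** B = B ** A"
  shows "adjoint_matrix A ** B = B ** adjoint_matrix A"
proof -
  have "adjoint_matrix A ** B = adjoint_matrix A ** (B ** A) ** adjoint_matrix A"
    using assms(1) by (metis unitary_matrix_def matrix_mul_assoc matrix_mul_rid)
  also have "\<dots> = B ** adjoint_matrix A"
    using assms by (metis unitary_matrix_def matrix_mul_assoc matrix_mul_lid)
  finally show ?thesis .
qed

text \<open>A unitary \<open>A\<close> near \<open>1\<close> is determined by its skew-Hermitian part \<open>K\<close>: its Hermitian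
  part is the square root of \<open>1 + K\<^sup>2\<close> near \<open>1\<close>.\<close>

lemma SU_coord_commute_iff:
  fixes A B :: "complex^'n^'n"
  assumes K: "\<And>X Y. norm ((X :: complex^'n^'n) ** (Y :: complex^'n^'n)) \<le> norm X * norm Y * K"
    and A: "unitary_matrix A" and near: "norm ((1/2) *\<^sub>R (A + adjoint_matrix A) - mat 1) * K < 1"
  shows "SU_coord A ** B = B ** SU_coord A \<longleftrightarrow> A ** B = B ** A"
proof -
  define S where "S = (1/2) *\<^sub>R (A + adjoint_matrix A)"
  define T where "T = (1/2) *\<^sub>R (A - adjoint_matrix A)"
  have AS: "A = S + T" and AT: "adjoint_matrix A = S - T"
    by (simp_all add: S_def T_def vec_eq_iff complex_eq_iff field_simps)
  have un: "adjoint_matrix A ** A = mat 1" "A ** adjoint_matrix A = mat 1"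
    using A by (auto simp: unitary_matrix_def)
  \<comment> \<open>For unitary \<open>A\<close> the quadratic term vanishes, leaving the
    skew-Hermitian part plus a scalar matrix, which commutes with everything.\<close>
  obtain z where "SU_coord A = T + mat z"
    using un by (simp add: SU_coord_def T_def)
  then have iff: "SU_coord A ** B = B ** SU_coord A \<longleftrightarrow> T ** B = B ** T"
    by (simp add: mmult.add_left mmult.add_right mat_commute)
  show ?thesis unfolding iff
  proof
    assume T: "T ** B = B ** T"
    \<comment> \<open>The symmetrised product (A A* + A* A)/2 cancels the mixed terms of S and T,
      which are not known to commute; unitarity makes it 1.\<close>
    have "S ** S - T ** T = (1/2) *\<^sub>R ((S + T) ** (S - T) + (S - T) ** (S + T))"
      by (simp add: mmult.add_left mmult.add_right mmult.diff_left mmult.diff_right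
          vec_eq_iff complex_eq_iff)
    also have "\<dots> = mat 1"
      using un by (simp add: AS[symmetric] AT[symmetric] scaleR_2[symmetric])
    finally have SS: "S ** S = mat 1 + T ** T" by (simp add: algebra_simps)
    have "(T ** T) ** B = B ** (T ** T)" using T by (metis matrix_mul_assoc)
    then have "(S ** S) ** B = B ** (S ** S)"
      unfolding SS by (simp add: mmult.add_left mmult.add_right)
    then have "S ** B = B ** S"
      using commute_square_root[OF K] near by (simp add: S_def)
    with T show "A ** B = B ** A" unfolding AS by (simp add: mmult.add_left mmult.add_right)
  next
    assume "A ** B = B ** A"
    with adjoint_matrix_commute[OF A this] show "T ** B = B ** T"
      unfolding T_def by (simp add: mmult.scaleR_left mmult.scaleR_right mmult.diff_left mmult.diff_right)
  qed
qed

lemma carrier_SU_group: "carrier SU_group = {A. unitary_matrix A \<and> det A = 1}"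
  by (simp add: SU_group_def)

text \<open>One neighbourhood \<open>U\<close> serves all matrices \<open>B\<close> at once, which
  is what lets the commutation conditions of an arbitrary, possibly infinite, set be straightened by
  the same chart.\<close>

lemma SU_coord_local_inverse:
  obtains U V g where "open U" "mat 1 \<in> U" "open V" "homeomorphism U V SU_coord g"
    "\<And>k. Ck_on k g V"
    "\<And>A :: complex^'n^'n. A \<in> U \<Longrightarrow> SU_coord A \<in> su_algebra \<longleftrightarrow> A \<in> carrier SU_group"
    "\<And>A B. A \<in> U \<Longrightarrow> A \<in> carrier SU_group \<Longrightarrow>
       SU_coord A ** B = B ** SU_coord A \<longleftrightarrow> A ** B = B ** A"
proof -
  obtain K where "K > 0" and K: "\<And>X Y. norm ((X :: complex^'n^'n) ** (Y :: complex^'n^'n)) \<le> norm X * norm Y * K"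
    using mmult.pos_bounded by blast
  \<comment> \<open>The first condition selects determinant 1 among the real values possible for
    unitary matrices, the second keeps the Hermitian part close enough to 1 for
    \<open>commute_square_root\<close>.\<close>
  define W :: "(complex^'n^'n) set" where
    "W = {A. Re (det A) > 0 \<and> norm ((1/2) *\<^sub>R (A + adjoint_matrix A) - mat 1) * K < 1}"
  have "open W"
    unfolding W_def
    by (intro open_Collect_conj open_Collect_less continuous_intros
        Ck_on_continuous[OF Ck_on_det] linear_continuous_on[OF bounded_linear_adjoint_matrix])
  have "mat 1 \<in> W"
    by (simp add: W_def scaleR_2[symmetric])
  have W: "SU_coord A \<in> su_algebra \<longleftrightarrow> A \<in> carrier SU_group" if "A \<in> W" for A
    using that det_unitary_eq_1[of A]
    by (auto simp: SU_coord_mem_su_algebra carrier_SU_group W_def unitary_matrix_def matrix_left_right_inverse)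
  have C: "SU_coord A ** B = B ** SU_coord A \<longleftrightarrow> A ** B = B ** A" if "A \<in> W" "A \<in> carrier SU_group" for A B
    using that by (intro SU_coord_commute_iff[OF K]) (auto simp: W_def carrier_SU_group)
  obtain U V g where "open U" "mat 1 \<in> U" "U \<subseteq> W" "open V" "homeomorphism U V SU_coord g" "\<And>k. Ck_on k g V"
    using smooth_inverse_function_theorem[OF \<open>open W\<close> \<open>mat 1 \<in> W\<close> Ck_on_subset[OF Ck_on_SU_coord]
        inj_frechet_derivative_SU_coord] by blast
  with that W C show thesis by blast
qed

section \<open>Slice charts for commutants\<close>

text \<open>The Lie algebra of the commutant subgroup. Commuting with a fixed matrix is a linear
  condition on \<open>X\<close>, so this is a subspace and can serve as the slice.\<close>

definition su_commutant :: "(complex^'n^'n) set \<Rightarrow> (complex^'n^'n) set" where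
  "su_commutant M = {X \<in> su_algebra. \<forall>B\<in>M. X ** B = B ** X}"

lemma subspace_su_algebra: "subspace (su_algebra :: (complex^'n^'n) set)"
  by (auto simp: subspace_def su_algebra_def adjoint_matrix_zero adjoint_matrix_add adjoint_matrix_scaleR
      trace_zero trace_add trace_scaleR)

lemma subspace_su_commutant: "subspace (su_commutant M)"
  using subspace_su_algebra
  by (auto simp: subspace_def su_commutant_def mmult.zero_left mmult.zero_right mmult.add_left
      mmult.add_right mmult.scaleR_left mmult.scaleR_right)

lemma adjoint_SU:
  assumes "p \<in> carrier SU_group"
  shows "adjoint_matrix p \<in> carrier SU_group" "adjoint_matrix p ** p = mat 1" "p ** adjoint_matrix p = mat 1"
  using assms by (auto simp: carrier_SU_group unitary_matrix_def det_adjoint_matrix)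

lemma mult_SU:
  "p \<in> carrier SU_group \<Longrightarrow> q \<in> carrier SU_group \<Longrightarrow> p ** q \<in> carrier SU_group"
  by (simp add: carrier_SU_group unitary_matrix_mult det_mul)

lemma mult_commutant_SU:
  "p \<in> commutant_SU M \<Longrightarrow> q \<in> commutant_SU M \<Longrightarrow> p ** q \<in> commutant_SU M"
  unfolding commutant_SU_def by (auto simp: mult_SU) (metis matrix_mul_assoc)

lemma adjoint_commutant_SU:
  "p \<in> commutant_SU M \<Longrightarrow> adjoint_matrix p \<in> commutant_SU M"
  unfolding commutant_SU_def
  by (auto simp: adjoint_SU intro!: adjoint_matrix_commute) (simp add: carrier_SU_group)

text \<open>Left multiplication by p* carries \<open>p\<close> to 1. It preserves the group and,
  because \<open>p\<close> lies in the commutant, the commutant as well, so the chart at the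
  identity pulls back to a slice chart at \<open>p\<close>.\<close>

lemma commutant_SU_slice_chart:
  fixes p :: "complex^'n^'n"
  assumes "p \<in> commutant_SU M"
  obtains U \<phi> where "p \<in> U" "smooth_chart (carrier SU_group) su_algebra U \<phi>"
    "\<phi> ` (U \<inter> commutant_SU M) = \<phi> ` U \<inter> su_commutant M"
proof -
  obtain U V g where U: "open U" "mat 1 \<in> U" and V: "open V" and hom: "homeomorphism U V SU_coord g"
    and g: "\<And>k. Ck_on k g V"
    and SU: "\<And>A :: complex^'n^'n. A \<in> U \<Longrightarrow> SU_coord A \<in> su_algebra \<longleftrightarrow> A \<in> carrier SU_group"
    and comm: "\<And>A B. A \<in> U \<Longrightarrow> A \<in> carrier SU_group \<Longrightarrow>
       SU_coord A ** B = B ** SU_coord A \<longleftrightarrow> A ** B = B ** A"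
    using SU_coord_local_inverse by blast
  have p: "p \<in> carrier SU_group" using assms by (simp add: commutant_SU_def)
  define \<phi> where "\<phi> = (\<lambda>A. SU_coord (adjoint_matrix p ** A))"
  define \<psi> where "\<psi> = (\<lambda>X. p ** g X)"
  define W where "W = {A. adjoint_matrix p ** A \<in> U}"
  let ?G = "carrier SU_group :: (complex^'n^'n) set"
  have cancel: "p ** (adjoint_matrix p ** A) = A" "adjoint_matrix p ** (p ** A) = A" for A :: "complex^'n^'n"
    using adjoint_SU[OF p] by (simp_all add: matrix_mul_assoc)
  have "open W"
    using open_vimage[OF U(1) linear_continuous_on[OF mmult.bounded_linear_right]]
    by (simp add: W_def vimage_def)
  have inG: "adjoint_matrix p ** A \<in> ?G \<longleftrightarrow> A \<in> ?G" for A
    using mult_SU[OF p] mult_SU[OF adjoint_SU(1)[OF p]] cancel(1) by metis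
  have inZ: "adjoint_matrix p ** A \<in> commutant_SU M \<longleftrightarrow> A \<in> commutant_SU M" for A
    using mult_commutant_SU[OF assms] mult_commutant_SU[OF adjoint_commutant_SU[OF assms]] cancel(1)
    by metis
  have \<psi>\<phi>: "\<psi> (\<phi> A) = A" if "A \<in> W" for A
    using that hom cancel by (simp add: \<psi>_def \<phi>_def W_def homeomorphism_def)
  have \<phi>\<psi>: "\<phi> (\<psi> X) = X" "\<psi> X \<in> W" if "X \<in> V" for X
    using that hom cancel by (auto simp: \<psi>_def \<phi>_def W_def homeomorphism_def)
  have \<phi>V: "\<phi> A \<in> V" if "A \<in> W" for A
    using that hom by (auto simp: \<phi>_def W_def homeomorphism_def)
  have \<phi>L: "\<phi> A \<in> su_algebra \<longleftrightarrow> A \<in> ?G" if "A \<in> W" for A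
    using SU that inG by (auto simp: \<phi>_def W_def)
  have \<phi>L': "\<phi> A \<in> su_commutant M \<longleftrightarrow> A \<in> commutant_SU M" if "A \<in> W" for A
  proof -
    have "\<phi> A \<in> su_commutant M \<longleftrightarrow> adjoint_matrix p ** A \<in> commutant_SU M"
      using that SU comm by (auto simp: \<phi>_def W_def su_commutant_def commutant_SU_def)
    then show ?thesis using inZ by simp
  qed
  \<comment> \<open>Used twice: with the whole group and \<open>su_algebra\<close> it computes the
    image of the chart, with the commutant and \<open>su_commutant M\<close> it gives the slice
    condition.\<close>
  have slice: "\<phi> ` (W \<inter> Z) = V \<inter> L" if "\<And>A. A \<in> W \<Longrightarrow> \<phi> A \<in> L \<longleftrightarrow> A \<in> Z" for Z L
  proof
    show "\<phi> ` (W \<inter> Z) \<subseteq> V \<inter> L" using \<phi>V that by blast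
    show "V \<inter> L \<subseteq> \<phi> ` (W \<inter> Z)"
    proof
      fix X assume X: "X \<in> V \<inter> L"
      then have "\<psi> X \<in> W \<inter> Z" using \<phi>\<psi>[of X] that[of "\<psi> X"] by auto
      then show "X \<in> \<phi> ` (W \<inter> Z)" using \<phi>\<psi>(1)[of X] X by (intro image_eqI[of _ _ "\<psi> X"]) auto
    qed
  qed
  have image: "\<phi> ` (W \<inter> ?G) = V \<inter> su_algebra"
    by (rule slice) (rule \<phi>L)
  have inj: "inj_on \<phi> (W \<inter> ?G)"
    using \<psi>\<phi> by (intro inj_on_inverseI[of _ \<psi>]) auto
  show thesis
  proof
    show "p \<in> W \<inter> ?G" using U(2) p adjoint_SU[OF p] by (simp add: W_def)
    show "\<phi> ` (W \<inter> ?G \<inter> commutant_SU M) = \<phi> ` (W \<inter> ?G) \<inter> su_commutant M"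
    proof -
      have "W \<inter> ?G \<inter> commutant_SU M = W \<inter> commutant_SU M"
        "V \<inter> su_algebra \<inter> su_commutant M = V \<inter> su_commutant M"
        by (auto simp: commutant_SU_def su_commutant_def)
      with slice[OF \<phi>L'] show ?thesis by (simp only: image)
    qed
    have "smooth_map (W \<inter> ?G) \<phi>"
      unfolding smooth_map_def
    proof (intro ballI exI conjI allI)
      show "Ck_on k \<phi> UNIV" for k
        unfolding \<phi>_def
        by (rule Ck_on_compose[OF open_UNIV open_UNIV _ Ck_on_linear[OF mmult.bounded_linear_right] Ck_on_SU_coord]) simp
    qed auto
    moreover have "smooth_map (V \<inter> su_algebra) (inv_into (W \<inter> ?G) \<phi>)"
      unfolding smooth_map_def
    proof (intro ballI exI conjI allI)
      show "Ck_on k \<psi> V" for k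
        unfolding \<psi>_def by (rule Ck_on_bounded_linear[OF mmult.bounded_linear_right V g])
      \<comment> \<open>The inverse chart is the restriction of \<open>\<psi>\<close>, which is
        smooth on the open set \<open>V\<close> of the ambient matrix space and so is the required
        local extension.\<close>
      show "\<psi> X = inv_into (W \<inter> ?G) \<phi> X" if "X \<in> V \<inter> (V \<inter> su_algebra)" for X
        using that \<phi>\<psi>[of X] \<phi>L[of "\<psi> X"] by (intro inv_into_f_eq[OF inj, symmetric]) auto
    qed (auto simp: V)
    ultimately show "smooth_chart ?G su_algebra (W \<inter> ?G) \<phi>"
      unfolding smooth_chart_def image
      using inj \<open>open W\<close> V subspace_su_algebra by (auto simp: openin_open)
  qed
qed

lemma smooth_manifold_SU: "smooth_manifold (dim (su_algebra :: (complex^'n^'n) set)) (carrier SU_group :: (complex^'n^'n) set)"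
  unfolding smooth_manifold_def
proof
  fix p :: "complex^'n^'n" assume "p \<in> carrier SU_group"
  \<comment> \<open>The commutant of the empty set is the whole group, so slice charts for it are in
    particular charts around every point of the group.\<close>
  then have "p \<in> commutant_SU {}" by (simp add: commutant_SU_def)
  then show "\<exists>L U \<phi>. p \<in> U \<and> dim L = dim (su_algebra :: (complex^'n^'n) set) \<and> smooth_chart (carrier SU_group) L U \<phi>"
    by (rule commutant_SU_slice_chart) blast
qed

text \<open>The same pair of subspaces \<open>su_algebra\<close> and \<open>su_commutant M\<close>
  works at every point, so both dimensions are constant.\<close>

lemma embedded_submanifold_commutant_SU:
  fixes M :: "(complex^'n^'n) set"
  shows "embedded_submanifold (carrier SU_group) (commutant_SU M)"
proof -
  let ?k = "dim (su_algebra :: (complex^'n^'n) set)"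
  have "\<exists>L L' U \<phi>. p \<in> U \<and> dim L = ?k \<and> smooth_chart (carrier SU_group) L U \<phi> \<and>
      subspace L' \<and> L' \<subseteq> L \<and> dim L' = dim (su_commutant M) \<and> \<phi> ` (U \<inter> commutant_SU M) = \<phi> ` U \<inter> L'"
    if "p \<in> commutant_SU M" for p
  proof -
    obtain U \<phi> where "p \<in> U" "smooth_chart (carrier SU_group) su_algebra U \<phi>"
      "\<phi> ` (U \<inter> commutant_SU M) = \<phi> ` U \<inter> su_commutant M"
      using \<open>p \<in> commutant_SU M\<close> by (rule commutant_SU_slice_chart)
    moreover have "su_commutant M \<subseteq> su_algebra" by (auto simp: su_commutant_def)
    ultimately show ?thesis
      using subspace_su_commutant[of M] by blast
  qed
  moreover have "commutant_SU M \<subseteq> carrier SU_group" by (auto simp: commutant_SU_def)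
  ultimately show ?thesis
    unfolding embedded_submanifold_def using smooth_manifold_SU[where 'n = 'n] by blast
qed

section \<open>Subgroup property and compactness of the commutant\<close>

lemma subgroup_commutant_SU: "subgroup (commutant_SU M) (SU_group :: (complex^'n^'n) monoid)"
proof (rule group.subgroupI[OF group_SU_group])
  show "commutant_SU M \<noteq> {}"
    by (auto simp: commutant_SU_def carrier_SU_group unitary_matrix_one intro!: exI[of _ "mat 1"])
  fix p :: "complex^'n^'n" assume p: "p \<in> commutant_SU M"
  then have "p \<in> carrier SU_group" by (simp add: commutant_SU_def)
  then have "inv\<^bsub>SU_group\<^esub> p = adjoint_matrix p"
    using adjoint_SU[of p] group.inv_equality[OF group_SU_group, of "adjoint_matrix p" p]
    by (simp add: SU_group_def)
  then show "inv\<^bsub>SU_group\<^esub> p \<in> commutant_SU M"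
    using adjoint_commutant_SU[OF p] by simp
  fix q assume "q \<in> commutant_SU M"
  with p show "p \<otimes>\<^bsub>SU_group\<^esub> q \<in> commutant_SU M"
    using mult_commutant_SU by (simp add: SU_group_def)
qed (auto simp: commutant_SU_def)

text \<open>The diagonal entries of A*A are the squared lengths of the columns of \<open>A\<close>,
  so every column is a unit vector.\<close>

lemma norm_unitary_matrix_entry_le:
  assumes "unitary_matrix A"
  shows "norm (A $ i $ j) \<le> 1"
proof -
  have "of_real (\<Sum>k\<in>UNIV. (norm (A $ k $ j))\<^sup>2) = (adjoint_matrix A ** A) $ j $ j"
    by (simp add: adjoint_matrix_def matrix_matrix_mult_def complex_norm_square mult.commute del: of_real_power)
  also have "\<dots> = of_real 1" using assms by (simp add: unitary_matrix_def mat_def)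
  finally have "(\<Sum>k\<in>UNIV. (norm (A $ k $ j))\<^sup>2) = 1" by (simp only: of_real_eq_iff)
  then have "(norm (A $ i $ j))\<^sup>2 \<le> 1"
    using member_le_sum[of i UNIV "\<lambda>k. (norm (A $ k $ j))\<^sup>2"] by simp
  then show ?thesis by (simp add: power_le_one_iff abs_square_le_1)
qed

text \<open>Heine-Borel in the ambient matrix space: the entry bound gives boundedness, and the set
  is an intersection, over all of \<open>M\<close>, of solution sets of continuous
  equations.\<close>

lemma compact_commutant_SU: "compact (commutant_SU M :: (complex^'n^'n) set)"
proof -
  have "norm A \<le> (\<Sum>i::'n\<in>UNIV. \<Sum>j::'n\<in>UNIV. 1)" if "unitary_matrix A" for A :: "complex^'n^'n"
  proof -
    have row: "norm (A $ i) \<le> (\<Sum>j::'n\<in>UNIV. 1)" for i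
      unfolding norm_vec_def
      by (rule order_trans[OF L2_set_le_sum]) (simp, intro sum_mono norm_unitary_matrix_entry_le that)
    show ?thesis
      unfolding norm_vec_def[of A] by (rule order_trans[OF L2_set_le_sum]) (simp, intro sum_mono row)
  qed
  then have "bounded (commutant_SU M)"
    unfolding bounded_iff by (auto simp: commutant_SU_def carrier_SU_group)
  moreover have "closed (commutant_SU M)"
  proof -
    have "commutant_SU M = {A. adjoint_matrix A ** A = mat 1} \<inter> {A. A ** adjoint_matrix A = mat 1}
        \<inter> {A. det A = 1} \<inter> (\<Inter>B\<in>M. {A. A ** B = B ** A})"
      by (auto simp: commutant_SU_def carrier_SU_group unitary_matrix_def)
    also have "closed \<dots>"
      by (intro closed_Int closed_INT ballI closed_Collect_eq mmult.continuous_on continuous_intros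
          Ck_on_continuous[OF Ck_on_det] linear_continuous_on[OF bounded_linear_adjoint_matrix])
    finally show ?thesis .
  qed
  ultimately show ?thesis by (simp add: compact_eq_bounded_closed)
qed

theorem theorem3p10:
  fixes N :: nat and M :: "(complex^'n^'n) set"
  assumes "N \<ge> 1" and "CARD('n) = 2 ^ N"
  shows "compact_Lie_subgroup (SU_group :: (complex^'n^'n) monoid) (commutant_SU M)"
  unfolding compact_Lie_subgroup_def
  by (intro conjI subgroup_commutant_SU compact_commutant_SU embedded_submanifold_commutant_SU)

end
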